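(* Let $\rho>0$ and let $Q:\mathbb{R}\to\mathbb{R}$ be a function such that $x\mapsto Q(x)-\rho x^{2}$ is convex on $\mathbb{R}$. For $n\ge 2$ and $\mathbf{x}=(x_{1},\dots,x_{n})\in\mathbb{R}^{n}$ set $$E^{Q}_{n}(\mathbf{x})=\frac1n\sum_{i=1}^{n}Q(x_{i})-\frac{2}{n(n-1)}\sum_{1\le i<j\le n}\log|x_{i}-x_{j}|,$$ and let $\Delta^{Q}_{n}=\inf\{E^{Q}_{n}(\mathbf{x}):\mathbf{x}\in\mathbb{R}^{n}\}$. If $\mathbf{y}\in\mathbb{R}^{n}$ satisfies $E^{Q}_{n}(\mathbf{y})=\Delta^{Q}_{n}$, then for every $\mathbf{x}\in\mathbb{R}^{n}$, $$\rho\,\bigl(W_{2}(\mu(\mathbf{x}),\mu(\mathbf{y}))\bigr)^{2}\le E^{Q}_{n}(\mathbf{x})-E^{Q}_{n}(\mathbf{y})=E^{Q}_{n}(\mathbf{x})-\Delta^{Q}_{n},$$ where $\mu(\mathbf{x})=\frac1n\sum_{k=1}^{n}\delta_{x_{k}}$. Moreover, for every $n\ge 2$, $$\Delta^{Q}_{n}\le\Delta^{Q}_{n+1}.$$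
   Context: $W_{2}(\mu,\nu)=\sqrt{\inf_{\pi\in\Pi(\mu,\nu)}\iint|x-y|^{2}\,d\pi(x,y)}$ is the Wasserstein distance between probability measures on $\mathbb{R}$ with finite second moment, where $\Pi(\mu,\nu)$ is the set of probability measures on $\mathbb{R}^{2}$ with marginals $\mu$ and $\nu$. $\delta_{x}$ is the Dirac mass at $x$. By convention $-\log 0=+\infty$, so $E^{Q}_{n}(\mathbf{x})=+\infty$ if two coordinates of $\mathbf{x}$ coincide. *)

theory Defs
  imports "HOL-Probability.Probability"
begin

section \<open>Wasserstein distance on the real line\<close>

definition couplings :: "real measure \<Rightarrow> real measure \<Rightarrow> (real \<times> real) measure set" where
  "couplings \<mu> \<nu> = {\<pi>. prob_space \<pi> \<and> sets \<pi> = sets (borel \<Otimes>\<^sub>M borel)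
     \<and> distr \<pi> borel fst = \<mu> \<and> distr \<pi> borel snd = \<nu>}"

definition transport_cost :: "real measure \<Rightarrow> real measure \<Rightarrow> ennreal" where
  "transport_cost \<mu> \<nu> = (INF \<pi>\<in>couplings \<mu> \<nu>. \<integral>\<^sup>+ (x, y). ennreal (\<bar>x - y\<bar>\<^sup>2) \<partial>\<pi>)"

text \<open>The cost is finite whenever both measures have finite second moment
  (lemma \<open>transport_cost_finite\<close> below), so on these measures \<^const>\<open>enn2real\<close> loses nothing.\<close>

definition W2 :: "real measure \<Rightarrow> real measure \<Rightarrow> real" where
  "W2 \<mu> \<nu> = sqrt (enn2real (transport_cost \<mu> \<nu>))"

lemma transport_cost_finite:
  fixes \<mu> \<nu> :: "real measure"
  assumes "prob_space \<mu>" "sets \<mu> = sets borel" "(\<integral>\<^sup>+ x. ennreal (x\<^sup>2) \<partial>\<mu>) < \<infinity>"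
    and "prob_space \<nu>" "sets \<nu> = sets borel" "(\<integral>\<^sup>+ x. ennreal (x\<^sup>2) \<partial>\<nu>) < \<infinity>"
  shows "transport_cost \<mu> \<nu> < \<infinity>"
proof -
  interpret M: prob_space \<mu> by fact
  interpret N: prob_space \<nu> by fact
  interpret pair_prob_space \<mu> \<nu> ..
  note [measurable_cong] = assms(2,5)
  let ?P = "\<mu> \<Otimes>\<^sub>M \<nu>"
  have fst: "distr ?P borel fst = \<mu>"
  proof -
    have "distr ?P borel fst = distr ?P \<mu> fst"
      by (rule distr_cong) (simp_all add: assms)
    also have "\<dots> = \<mu>" by (simp add: N.distr_pair_fst N.emeasure_space_1)
    finally show ?thesis .
  qed
  have snd: "distr ?P borel snd = \<nu>"
  proof -
    have "distr ?P borel snd = distr (distr (\<nu> \<Otimes>\<^sub>M \<mu>) ?P (\<lambda>(x, y). (y, x))) \<nu> snd"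
      by (rule distr_cong) (simp_all add: assms distr_pair_swap [symmetric])
    also have "\<dots> = distr (\<nu> \<Otimes>\<^sub>M \<mu>) \<nu> fst"
      by (subst distr_distr) (auto intro!: distr_cong simp: comp_def split_beta)
    also have "\<dots> = \<nu>" by (simp add: M.distr_pair_fst M.emeasure_space_1)
    finally show ?thesis .
  qed
  have "?P \<in> couplings \<mu> \<nu>"
    unfolding couplings_def using fst snd
    by (auto intro: prob_space_axioms sets_pair_measure_cong simp: assms)
  then have "transport_cost \<mu> \<nu> \<le> (\<integral>\<^sup>+ (x, y). ennreal (\<bar>x - y\<bar>\<^sup>2) \<partial>?P)"
    unfolding transport_cost_def by (rule INF_lower)
  also have "\<dots> \<le> (\<integral>\<^sup>+ z. 2 * ennreal ((fst z)\<^sup>2) + 2 * ennreal ((snd z)\<^sup>2) \<partial>?P)"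
  proof (rule nn_integral_mono, clarsimp)
    fix a b :: real
    have "(a - b)\<^sup>2 \<le> 2 * a\<^sup>2 + 2 * b\<^sup>2"
      using zero_le_power2[of "a + b"] by (simp add: power2_eq_square algebra_simps)
    then have "ennreal ((a - b)\<^sup>2) \<le> ennreal (2 * a\<^sup>2 + 2 * b\<^sup>2)" by (rule ennreal_leI)
    then show "ennreal ((a - b)\<^sup>2) \<le> 2 * ennreal (a\<^sup>2) + 2 * ennreal (b\<^sup>2)"
      by (simp add: ennreal_plus ennreal_mult)
  qed
  also have "\<dots> = 2 * (\<integral>\<^sup>+ z. ennreal ((fst z)\<^sup>2) \<partial>?P) + 2 * (\<integral>\<^sup>+ z. ennreal ((snd z)\<^sup>2) \<partial>?P)"
    by (subst nn_integral_add) (auto simp: nn_integral_cmult)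
  also have "(\<integral>\<^sup>+ z. ennreal ((fst z)\<^sup>2) \<partial>?P) = (\<integral>\<^sup>+ x. ennreal (x\<^sup>2) \<partial>\<mu>)"
    by (subst (2) fst [symmetric]) (simp add: nn_integral_distr)
  also have "(\<integral>\<^sup>+ z. ennreal ((snd z)\<^sup>2) \<partial>?P) = (\<integral>\<^sup>+ x. ennreal (x\<^sup>2) \<partial>\<nu>)"
    by (subst (2) snd [symmetric]) (simp add: nn_integral_distr)
  finally have "transport_cost \<mu> \<nu>
      \<le> 2 * (\<integral>\<^sup>+ x. ennreal (x\<^sup>2) \<partial>\<mu>) + 2 * (\<integral>\<^sup>+ x. ennreal (x\<^sup>2) \<partial>\<nu>)" .
  also have "\<dots> < \<infinity>"
    using assms(3,6) by (simp add: ennreal_mult_less_top less_top)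
  finally show ?thesis .
qed

section \<open>Empirical measures and the energy\<close>

text \<open>Points of the space of real \<open>n\<close>-tuples are the extensional functions on \<open>{1..n}\<close>, so that
  \<open>n\<close> can be an ordinary variable.\<close>

abbreviation Rn :: "nat \<Rightarrow> (nat \<Rightarrow> real) set" where
  "Rn n \<equiv> {1..n} \<rightarrow>\<^sub>E (UNIV :: real set)"

definition empirical :: "nat \<Rightarrow> (nat \<Rightarrow> real) \<Rightarrow> real measure" where
  "empirical n x = measure_of UNIV (sets borel)
     (\<lambda>A. ennreal (1 / real n) * (\<Sum>k=1..n. emeasure (return borel (x k)) A))"

text \<open>Extended logarithm; \<^term>\<open>ln (0::real)\<close> is \<open>0\<close> in the library.\<close>

definition elog :: "real \<Rightarrow> ereal" where
  "elog r = (if r = 0 then -\<infinity> else ereal (ln r))"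

definition energy :: "(real \<Rightarrow> real) \<Rightarrow> nat \<Rightarrow> (nat \<Rightarrow> real) \<Rightarrow> ereal" where
  "energy Q n x = ereal (1 / real n * (\<Sum>i=1..n. Q (x i)))
     - ereal (2 / (real n * (real n - 1))) * (\<Sum>i=1..n. \<Sum>j\<in>{i<..n}. elog \<bar>x i - x j\<bar>)"

definition min_energy :: "(real \<Rightarrow> real) \<Rightarrow> nat \<Rightarrow> ereal" where
  "min_energy Q n = (INF x\<in>Rn n. energy Q n x)"

lemma sets_empirical [simp]: "sets (empirical n x) = sets borel"
  using sigma_algebra.sets_measure_of_eq[OF sets.sigma_algebra_axioms[of "borel :: real measure"]]
  by (simp add: empirical_def)

lemma emeasure_empirical:
  assumes "A \<in> sets borel"
  shows "emeasure (empirical n x) A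
    = ennreal (1 / real n) * (\<Sum>k=1..n. emeasure (return borel (x k)) A)"
  unfolding empirical_def
proof (rule emeasure_measure_of_sigma)
  show "sigma_algebra UNIV (sets (borel :: real measure))"
    using sets.sigma_algebra_axioms[of "borel :: real measure"] by simp
  show "countably_additive (sets borel)
     (\<lambda>A. ennreal (1 / real n) * (\<Sum>k=1..n. emeasure (return borel (x k)) A))"
  proof (rule countably_additiveI)
    fix B :: "nat \<Rightarrow> real set"
    assume B: "range B \<subseteq> sets borel" "disjoint_family B"
    have "(\<Sum>i. \<Sum>k=1..n. emeasure (return borel (x k)) (B i))
      = (\<Sum>k=1..n. \<Sum>i. emeasure (return borel (x k)) (B i))"
      by (rule suminf_sum) simp
    also have "\<dots> = (\<Sum>k=1..n. emeasure (return borel (x k)) (\<Union>i. B i))"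
      using B by (intro sum.cong suminf_emeasure) auto
    finally show "(\<Sum>i. ennreal (1 / real n) * (\<Sum>k=1..n. emeasure (return borel (x k)) (B i)))
      = ennreal (1 / real n) * (\<Sum>k=1..n. emeasure (return borel (x k)) (\<Union>i. B i))"
      by simp
  qed
qed (use assms in \<open>auto simp: positive_def\<close>)

lemma prob_space_empirical:
  assumes "n \<ge> 1"
  shows "prob_space (empirical n x)"
proof
  have "space (empirical n x) = UNIV"
    using sets_eq_imp_space_eq[OF sets_empirical] by simp
  then show "emeasure (empirical n x) (space (empirical n x)) = 1"
    using assms
    by (simp add: emeasure_empirical ennreal_of_nat_eq_real_of_nat flip: ennreal_mult)
qed

end

theory Submission
  imports Defs
begin

text \<open>On the chamber of configurations with a given strict ordering of the coordinates, the
  energy is strongly convex: \<open>Q\<close> contributes the modulus \<open>\<rho>\<close>, and \<open>-ln\<close> of the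
  gaps is convex. Comparing a minimiser \<open>y\<close> with points of the segment from \<open>y\<close> to \<open>x\<close> that
  tend to \<open>y\<close> bounds the quadratic cost of the pairing of order statistics, hence the squared
  Wasserstein distance. Monotonicity of the minimal energy holds because the energy of
  \<open>n + 1\<close> points is the average of the energies of the \<open>n + 1\<close> configurations
  obtained by leaving out one point.\<close>

section \<open>Real-valued energy on an arbitrary index set\<close>

definition config_energy :: "(real \<Rightarrow> real) \<Rightarrow> 'a set \<Rightarrow> ('a \<Rightarrow> real) \<Rightarrow> real" where
  "config_energy Q I x = (\<Sum>i\<in>I. Q (x i)) / card I
     - (\<Sum>i\<in>I. \<Sum>j\<in>I - {i}. ln \<bar>x i - x j\<bar>) / (card I * (real (card I) - 1))"

lemma config_energy_reindex:
  assumes "bij_betw f J I"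
  shows "config_energy Q I x = config_energy Q J (x \<circ> f)"
proof -
  have "(\<Sum>j\<in>I - {f i}. ln \<bar>x (f i) - x j\<bar>) = (\<Sum>j\<in>J - {i}. ln \<bar>x (f i) - x (f j)\<bar>)"
    if "i \<in> J" for i
  proof -
    have "bij_betw f (J - {i}) (I - {f i})"
      using assms that by (auto simp: bij_betw_def inj_on_def)
    from sum.reindex_bij_betw[OF this, of "\<lambda>j. ln \<bar>x (f i) - x j\<bar>"] show ?thesis by simp
  qed
  moreover have "card J = card I" using bij_betw_same_card[OF assms] .
  ultimately show ?thesis
    unfolding config_energy_def
    by (subst (1 2) sum.reindex_bij_betw[OF assms, symmetric]) (simp cong: sum.cong)
qed

text \<open>Symmetry folds the pairs below the diagonal onto those above it.\<close>

lemma sum_ordered_pairs: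
  fixes g :: "nat \<Rightarrow> nat \<Rightarrow> real"
  assumes sym: "\<And>i j. g i j = g j i"
  shows "(\<Sum>i=1..n. \<Sum>j\<in>{1..n} - {i}. g i j) = 2 * (\<Sum>i=1..n. \<Sum>j\<in>{i<..n}. g i j)"
proof -
  have "(\<Sum>j\<in>{1..n} - {i}. g i j) = (\<Sum>j\<in>{i<..n}. g i j) + (\<Sum>j\<in>{1..<i}. g i j)"
    if "i \<in> {1..n}" for i
  proof -
    have "{1..n} - {i} = {i<..n} \<union> {1..<i}" using that by auto
    then show ?thesis by (simp add: sum.union_disjoint Int_def)
  qed
  then have "(\<Sum>i=1..n. \<Sum>j\<in>{1..n} - {i}. g i j)
      = (\<Sum>i=1..n. \<Sum>j\<in>{i<..n}. g i j) + (\<Sum>i=1..n. \<Sum>j\<in>{1..<i}. g i j)"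
    by (simp add: sum.distrib)
  also have "(\<Sum>i=1..n. \<Sum>j\<in>{1..<i}. g i j) = (\<Sum>i=1..n. \<Sum>j | j \<in> {1..n} \<and> j < i. g i j)"
    by (intro sum.cong) auto
  also have "\<dots> = (\<Sum>j=1..n. \<Sum>i | i \<in> {1..n} \<and> j < i. g i j)"
    by (rule sum.swap_restrict) auto
  also have "\<dots> = (\<Sum>j=1..n. \<Sum>i\<in>{j<..n}. g j i)"
    by (intro sum.cong) (auto simp: sym)
  finally show ?thesis by simp
qed

lemma energy_eq_config_energy:
  assumes "inj_on x {1..n}"
  shows "energy Q n x = ereal (config_energy Q {1..n} x)"
proof -
  have "elog \<bar>x i - x j\<bar> = ereal (ln \<bar>x i - x j\<bar>)" if "i \<in> {1..n}" "j \<in> {i<..n}" for i j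
    using inj_onD[OF assms, of i j] that by (auto simp: elog_def)
  then have "(\<Sum>i=1..n. \<Sum>j\<in>{i<..n}. elog \<bar>x i - x j\<bar>)
      = ereal (\<Sum>i=1..n. \<Sum>j\<in>{i<..n}. ln \<bar>x i - x j\<bar>)"
    by simp
  moreover have "(\<Sum>i=1..n. \<Sum>j\<in>{1..n} - {i}. ln \<bar>x i - x j\<bar>)
      = 2 * (\<Sum>i=1..n. \<Sum>j\<in>{i<..n}. ln \<bar>x i - x j\<bar>)"
    by (rule sum_ordered_pairs) (simp add: abs_minus_commute)
  ultimately show ?thesis
    unfolding energy_def config_energy_def by (simp only:) simp
qed

text \<open>In \<open>ereal\<close> the sum of \<open>\<infinity>\<close> and
  \<open>-\<infinity>\<close> is \<open>\<infinity>\<close>, so infinite positive terms must be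
  excluded.\<close>

lemma sum_ereal_eq_MInfty:
  fixes f :: "'a \<Rightarrow> ereal"
  assumes "finite A" "a \<in> A" "f a = -\<infinity>" "\<And>i. i \<in> A \<Longrightarrow> f i \<noteq> \<infinity>"
  shows "sum f A = -\<infinity>"
proof -
  have "sum f (A - {a}) \<noteq> \<infinity>" using assms(4) by (auto simp: sum_Pinfty)
  with assms show ?thesis by (simp add: sum.remove[of A a])
qed

text \<open>One coinciding pair drives the double sum to \<open>-\<infinity>\<close>, and
  \<open>n \<ge> 2\<close> makes its coefficient positive.\<close>

lemma energy_eq_PInfty:
  assumes "\<not> inj_on x {1..n}" "n \<ge> 2"
  shows "energy Q n x = \<infinity>"
proof -
  have fin: "(\<Sum>j\<in>{i<..n}. elog \<bar>x i - x j\<bar>) \<noteq> \<infinity>" for i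
    by (auto simp: sum_Pinfty elog_def)
  obtain i j where ij: "i \<in> {1..n}" "j \<in> {1..n}" "i < j" "x i = x j"
  proof -
    from assms(1) obtain a b where "a \<in> {1..n}" "b \<in> {1..n}" "a \<noteq> b" "x a = x b"
      by (auto simp: inj_on_def)
    then show thesis using that[of a b] that[of b a] by (cases "a < b") auto
  qed
  have "(\<Sum>j\<in>{i<..n}. elog \<bar>x i - x j\<bar>) = -\<infinity>"
    by (rule sum_ereal_eq_MInfty[of _ j]) (use ij in \<open>auto simp: elog_def\<close>)
  then have "(\<Sum>i=1..n. \<Sum>j\<in>{i<..n}. elog \<bar>x i - x j\<bar>) = -\<infinity>"
    by (rule sum_ereal_eq_MInfty[OF finite_atLeastAtMost ij(1)]) (rule fin)
  then show ?thesis using assms(2) by (simp add: energy_def)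
qed

text \<open>Numbering \<open>I\<close> by \<open>{1..card I}\<close> makes configurations with gaps
  in their index set competitors for the infimum.\<close>

lemma min_energy_le_config_energy:
  assumes "finite I" "inj_on x I"
  shows "min_energy Q (card I) \<le> ereal (config_energy Q I x)"
proof -
  obtain f where f: "bij_betw f {1..card I} I"
    using ex_bij_betw_nat_finite_1[OF assms(1)] by blast
  \<comment> \<open>Members of \<open>Rn\<close> are extensional, hence the restriction.\<close>
  let ?z = "restrict (x \<circ> f) {1..card I}"
  have "inj_on ?z {1..card I}"
    using f assms(2) comp_inj_on[of f _ x] by (simp add: inj_on_restrict_eq bij_betw_def)
  then have "energy Q (card I) ?z = ereal (config_energy Q {1..card I} ?z)"
    by (rule energy_eq_config_energy)
  also have "config_energy Q {1..card I} ?z = config_energy Q I x"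
    unfolding config_energy_reindex[OF f] unfolding config_energy_def
    by (intro arg_cong2[where f = minus] arg_cong2[where f = divide] sum.cong) simp_all
  finally show ?thesis
    unfolding min_energy_def by (metis INF_lower restrict_PiE_iff UNIV_I)
qed

section \<open>Strong convexity along segments\<close>

text \<open>The last term is the convexity defect of the square: the chord exceeds it by exactly
  \<open>t * (1 - t) * (b - a)\<^sup>2\<close>.\<close>

lemma strongly_convex_bound:
  fixes Q :: "real \<Rightarrow> real"
  assumes "convex_on UNIV (\<lambda>x. Q x - \<rho> * x\<^sup>2)" "0 \<le> t" "t \<le> 1"
  shows "Q ((1 - t) * a + t * b) \<le> (1 - t) * Q a + t * Q b - \<rho> * t * (1 - t) * (b - a)\<^sup>2"
  using convex_onD[OF assms(1-3), of a b] by (simp add: power2_eq_square algebra_simps)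

text \<open>For \<open>a\<close> and \<open>b\<close> of equal sign the absolute value is affine
  between them, which leaves concavity of \<open>ln\<close>.\<close>

lemma ln_abs_concave:
  fixes a b t :: real
  assumes "0 < a * b" "0 \<le> t" "t \<le> 1"
  shows "(1 - t) * ln \<bar>a\<bar> + t * ln \<bar>b\<bar> \<le> ln \<bar>(1 - t) * a + t * b\<bar>"
proof -
  have "\<bar>(1 - t) * a + t * b\<bar> = (1 - t) * \<bar>a\<bar> + t * \<bar>b\<bar>"
  proof (cases "0 < a")
    case True
    with assms have "0 < b" by (simp add: zero_less_mult_iff)
    with True assms show ?thesis by simp
  next
    case False
    with assms have ab: "a < 0" "b < 0" by (auto simp: zero_less_mult_iff)
    then have "(1 - t) * a \<le> 0" "t * b \<le> 0"
      using assms by (simp_all add: mult_nonneg_nonpos)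
    with ab show ?thesis by simp
  qed
  moreover have "a \<noteq> 0" "b \<noteq> 0" using assms(1) by auto
  ultimately show ?thesis
    using concave_onD[OF ln_concave assms(2,3), of "\<bar>a\<bar>" "\<bar>b\<bar>"] by simp
qed

text \<open>The hypothesis \<open>como\<close> says that \<open>x\<close> and \<open>y\<close> order
  the indices alike, so no gap changes sign along the segment and each logarithm is concave
  there.\<close>

lemma config_energy_strongly_convex:
  assumes conv: "convex_on UNIV (\<lambda>x. Q x - \<rho> * x\<^sup>2)" and t: "0 \<le> t" "t \<le> 1"
    and como: "\<And>i j. i \<in> I \<Longrightarrow> j \<in> I \<Longrightarrow> i \<noteq> j \<Longrightarrow> 0 < (y i - y j) * (x i - x j)"
  shows "config_energy Q I (\<lambda>i. (1 - t) * y i + t * x i)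
    \<le> (1 - t) * config_energy Q I y + t * config_energy Q I x
      - \<rho> * t * (1 - t) * ((\<Sum>i\<in>I. (x i - y i)\<^sup>2) / card I)"
proof -
  let ?z = "\<lambda>i. (1 - t) * y i + t * x i"
  let ?L = "\<lambda>x. \<Sum>i\<in>I. \<Sum>j\<in>I - {i}. ln \<bar>x i - x j\<bar>"
  let ?S = "\<lambda>x. \<Sum>i\<in>I. Q (x i)"
  let ?D = "\<Sum>i\<in>I. (x i - y i)\<^sup>2"
  let ?c = "card I * (real (card I) - 1)"
  have "?S ?z \<le> (\<Sum>i\<in>I. (1 - t) * Q (y i) + t * Q (x i) - \<rho> * t * (1 - t) * (x i - y i)\<^sup>2)"
    by (intro sum_mono strongly_convex_bound conv t)
  also have "\<dots> = (1 - t) * ?S y + t * ?S x - \<rho> * t * (1 - t) * ?D"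
    by (simp add: sum.distrib sum_subtractf sum_distrib_left)
  finally have "?S ?z / card I \<le> ((1 - t) * ?S y + t * ?S x - \<rho> * t * (1 - t) * ?D) / card I"
    by (rule divide_right_mono) simp
  then have S: "?S ?z / card I
      \<le> (1 - t) * (?S y / card I) + t * (?S x / card I) - \<rho> * t * (1 - t) * (?D / card I)"
    by (simp add: add_divide_distrib diff_divide_distrib)
  have gap: "(1 - t) * ln \<bar>y i - y j\<bar> + t * ln \<bar>x i - x j\<bar> \<le> ln \<bar>?z i - ?z j\<bar>"
    if "i \<in> I" "j \<in> I - {i}" for i j
  proof -
    have "?z i - ?z j = (1 - t) * (y i - y j) + t * (x i - x j)" by (simp add: algebra_simps)
    then show ?thesis using ln_abs_concave[OF como t, of i j] that by auto
  qed
  have "(1 - t) * ?L y + t * ?L x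
      = (\<Sum>i\<in>I. \<Sum>j\<in>I - {i}. (1 - t) * ln \<bar>y i - y j\<bar> + t * ln \<bar>x i - x j\<bar>)"
    by (simp add: sum.distrib sum_distrib_left)
  also have "\<dots> \<le> ?L ?z"
    by (intro sum_mono gap)
  finally have "((1 - t) * ?L y + t * ?L x) / ?c \<le> ?L ?z / ?c"
    \<comment> \<open>The divisor is nonnegative even for \<open>card I = 0\<close>, where it
      vanishes.\<close>
    by (rule divide_right_mono) (cases "card I"; simp)
  then have "(1 - t) * (?L y / ?c) + t * (?L x / ?c) \<le> ?L ?z / ?c"
    by (simp only: add_divide_distrib times_divide_eq_right)
  with S show ?thesis
    unfolding config_energy_def right_diff_distrib by linarith
qed

text \<open>Minimality compares \<open>y\<close> with an interior point of the segment; the strong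
  convexity bound is then divided by \<open>t\<close>, and \<open>t\<close> tends to 0.\<close>

lemma config_energy_minimizer_gap:
  assumes conv: "convex_on UNIV (\<lambda>x. Q x - \<rho> * x\<^sup>2)"
    and como: "\<And>i j. i \<in> I \<Longrightarrow> j \<in> I \<Longrightarrow> i \<noteq> j \<Longrightarrow> 0 < (y i - y j) * (x i - x j)"
    and min: "\<And>z. inj_on z I \<Longrightarrow> config_energy Q I y \<le> config_energy Q I z"
  shows "\<rho> * ((\<Sum>i\<in>I. (x i - y i)\<^sup>2) / card I) \<le> config_energy Q I x - config_energy Q I y"
proof -
  define D where "D = (\<Sum>i\<in>I. (x i - y i)\<^sup>2) / card I"
  let ?E = "config_energy Q I"
  have bound: "\<rho> * (1 - t) * D \<le> ?E x - ?E y" if t: "0 < t" "t < 1" for t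
  proof -
    let ?z = "\<lambda>i. (1 - t) * y i + t * x i"
    \<comment> \<open>Minimality is available only against injective competitors; here equally
      signed gaps cannot cancel.\<close>
    have "inj_on ?z I"
    proof (rule inj_onI, rule ccontr)
      fix i j assume ij: "i \<in> I" "j \<in> I" "?z i = ?z j" "i \<noteq> j"
      then have "(1 - t) * (y i - y j) + t * (x i - x j) = 0" by (simp add: algebra_simps)
      moreover have "(1 - t) * (y i - y j) + t * (x i - x j) \<noteq> 0"
      proof (cases "0 < y i - y j")
        case True
        then have "0 < x i - x j" using como[OF ij(1,2,4)] by (simp add: zero_less_mult_iff)
        with True t have "0 < (1 - t) * (y i - y j)" "0 < t * (x i - x j)" by simp_all
        then show ?thesis by linarith
      next
        case False
        then have "y i - y j < 0" "x i - x j < 0"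
          using como[OF ij(1,2,4)] by (auto simp: zero_less_mult_iff)
        with t have "(1 - t) * (y i - y j) < 0" "t * (x i - x j) < 0"
          by (simp_all add: mult_pos_neg)
        then show ?thesis by linarith
      qed
      ultimately show False by simp
    qed
    then have "?E y \<le> ?E ?z" by (rule min)
    also have "?E ?z \<le> (1 - t) * ?E y + t * ?E x - \<rho> * t * (1 - t) * D"
      unfolding D_def using t
      by (intro config_energy_strongly_convex[OF conv]) (simp_all add: como)
    finally have "t * (\<rho> * (1 - t) * D) \<le> t * (?E x - ?E y)"
      by (simp add: algebra_simps)
    then show ?thesis using t by (simp only: mult_le_cancel_left_pos)
  qed
  \<comment> \<open>The limit removes the factor \<open>1 - t\<close>, giving the full constant
    \<open>\<rho>\<close>.\<close>
  have "((\<lambda>t. \<rho> * (1 - t) * D) \<longlongrightarrow> \<rho> * (1 - 0) * D) (at_right 0)"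
    by (intro tendsto_intros)
  moreover have "\<forall>\<^sub>F t in at_right 0. \<rho> * (1 - t) * D \<le> ?E x - ?E y"
    unfolding eventually_at_right_field using bound by (intro exI[of _ 1]) simp
  ultimately have "\<rho> * (1 - 0) * D \<le> ?E x - ?E y"
    by (rule tendsto_upperbound) simp
  then show ?thesis by (simp add: D_def)
qed

section \<open>Empirical measures, transport cost and sorting\<close>

lemma empirical_reindex:
  assumes "bij_betw f {1..n} {1..n}"
  shows "empirical n (x \<circ> f) = empirical n x"
proof -
  have "(\<Sum>k=1..n. emeasure (return borel (x (f k))) A)
      = (\<Sum>k=1..n. emeasure (return borel (x k)) A)" for A
    using sum.reindex_bij_betw[OF assms, of "\<lambda>k. emeasure (return borel (x k)) A"] .
  then show ?thesis by (simp add: empirical_def)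
qed

text \<open>Drawing an index uniformly and pairing \<open>x i\<close> with \<open>y i\<close> is a
  coupling whose cost is the right-hand side. Its optimality is never at issue, since only an upper
  bound on \<open>W2\<close> is wanted.\<close>

lemma W2_empirical_le:
  assumes "n \<ge> 1"
  shows "(W2 (empirical n x) (empirical n y))\<^sup>2 \<le> (\<Sum>i=1..n. (x i - y i)\<^sup>2) / n"
proof -
  let ?p = "measure_pmf (pmf_of_set {1..n})"
  let ?\<pi> = "distr ?p (borel \<Otimes>\<^sub>M borel) (\<lambda>i. (x i, y i))"
  have marg: "distr ?p borel z = empirical n z" for z
  proof (rule measure_eqI)
    fix A :: "real set" assume "A \<in> sets (distr ?p borel z)"
    then have A: "A \<in> sets borel" by simp
    have "emeasure (distr ?p borel z) A = (\<integral>\<^sup>+i. indicator A (z i) \<partial>?p)"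
      using nn_integral_distr[of z ?p borel "indicator A"] A by simp
    also have "\<dots> = (\<Sum>i=1..n. indicator A (z i) :: ennreal) / of_nat n"
      by (subst nn_integral_pmf_of_set) (use assms in simp_all)
    also have "\<dots> = ennreal (1 / real n) * (\<Sum>i=1..n. indicator A (z i))"
      using assms
      by (simp add: divide_ennreal_def ennreal_of_nat_eq_real_of_nat inverse_ennreal mult.commute
          inverse_eq_divide)
    finally show "emeasure (distr ?p borel z) A = emeasure (empirical n z) A"
      using A by (simp add: emeasure_empirical)
  qed simp
  have pair: "(\<lambda>i. (x i, y i)) \<in> ?p \<rightarrow>\<^sub>M borel \<Otimes>\<^sub>M borel"
    by (simp add: space_pair_measure)
  have "distr ?\<pi> borel fst = empirical n x" "distr ?\<pi> borel snd = empirical n y"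
    unfolding distr_distr[OF measurable_fst pair] distr_distr[OF measurable_snd pair]
      marg[symmetric]
    by (simp_all add: comp_def)
  with measure_pmf.prob_space_distr[OF pair]
  have "?\<pi> \<in> couplings (empirical n x) (empirical n y)"
    unfolding couplings_def by simp
  then have "transport_cost (empirical n x) (empirical n y)
      \<le> (\<integral>\<^sup>+ (x, y). ennreal (\<bar>x - y\<bar>\<^sup>2) \<partial>?\<pi>)"
    unfolding transport_cost_def by (rule INF_lower)
  also have "\<dots> = (\<Sum>i=1..n. ennreal ((x i - y i)\<^sup>2)) / n"
    using assms by (subst nn_integral_distr[OF pair]) (simp_all add: nn_integral_pmf_of_set)
  also have "\<dots> = ennreal ((\<Sum>i=1..n. (x i - y i)\<^sup>2) / n)"
    using assms by (simp add: ennreal_of_nat_eq_real_of_nat divide_ennreal sum_nonneg)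
  finally have "enn2real (transport_cost (empirical n x) (empirical n y))
      \<le> (\<Sum>i=1..n. (x i - y i)\<^sup>2) / n"
    by (intro enn2real_leI) (auto intro!: divide_nonneg_nonneg sum_nonneg)
  then show ?thesis by (simp add: W2_def)
qed

text \<open>Position \<open>k\<close> is sent to the index at which \<open>x\<close> takes its
  \<open>k\<close>-th smallest value; injectivity makes this index unique.\<close>

lemma ex_strict_mono_reindexing:
  fixes x :: "nat \<Rightarrow> 'a::linorder"
  assumes "inj_on x {1..n}"
  obtains f where "bij_betw f {1..n} {1..n}" "strict_mono_on {1..n} (x \<circ> f)"
proof -
  let ?M = "x ` {1..n}"
  let ?l = "sorted_list_of_set ?M"
  have card: "card ?M = n" using assms by (simp add: card_image)
  \<comment> \<open>The \<open>k\<close>-th order statistic; lists count from 0, configurations from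
    1.\<close>
  define h where "h = (\<lambda>k. ?l ! (k - 1))"
  have "bij_betw ((!) ?l) {..<n} ?M"
    by (rule bij_betw_nth) (simp_all only: card distinct_sorted_list_of_set set_sorted_list_of_set finite_imageI
        finite_atLeastAtMost length_sorted_list_of_set)
  moreover have "bij_betw (\<lambda>k. k - 1) {1..n} {..<n}"
    by (rule bij_betw_byWitness[where f' = Suc]) auto
  ultimately have h: "bij_betw h {1..n} ?M"
    using bij_betw_trans[of "\<lambda>k. k - 1"] unfolding h_def comp_def by blast
  let ?f = "inv_into {1..n} x \<circ> h"
  have "bij_betw ?f {1..n} {1..n}"
    by (rule bij_betw_trans[OF h]) (rule bij_betw_inv_into[OF inj_on_imp_bij_betw[OF assms]])
  moreover have "strict_mono_on {1..n} (x \<circ> ?f)"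
  proof (rule strict_mono_onI)
    fix i j assume ij: "i \<in> {1..n}" "j \<in> {1..n}" "i < j"
    have "h k \<in> ?M" if "k \<in> {1..n}" for k using h that by (auto simp: bij_betw_def)
    then have "(x \<circ> ?f) k = h k" if "k \<in> {1..n}" for k
      using that by (simp add: f_inv_into_f)
    moreover have "h i < h j"
      unfolding h_def
      by (rule sorted_wrt_nth_less[OF strict_sorted_list_of_set]) (use ij card in auto)
    ultimately show "(x \<circ> ?f) i < (x \<circ> ?f) j" using ij by simp
  qed
  ultimately show thesis using that by blast
qed

section \<open>Leave-one-out averaging\<close>

text \<open>Each index survives every removal but its own.\<close>

lemma sum_leave_one_out:
  fixes g :: "'a \<Rightarrow> real"
  assumes "finite I"
  shows "(\<Sum>k\<in>I. \<Sum>i\<in>I - {k}. g i) = (real (card I) - 1) * (\<Sum>i\<in>I. g i)"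
proof -
  have "(\<Sum>k\<in>I. \<Sum>i\<in>I - {k}. g i) = (\<Sum>k\<in>I. sum g I - g k)"
    using assms by (simp add: sum_diff1)
  also have "\<dots> = (real (card I) - 1) * sum g I"
    by (simp add: sum_subtractf algebra_simps)
  finally show ?thesis .
qed

text \<open>An ordered pair of distinct indices survives all removals but two. Exchanging the sums
  to fix \<open>i\<close> first reduces this to the single-index count on
  \<open>I - {i}\<close>.\<close>

lemma sum_pairs_leave_one_out:
  fixes g :: "'a \<Rightarrow> 'a \<Rightarrow> real"
  assumes "finite I"
  shows "(\<Sum>k\<in>I. \<Sum>i\<in>I - {k}. \<Sum>j\<in>I - {k} - {i}. g i j)
    = (real (card I) - 2) * (\<Sum>i\<in>I. \<Sum>j\<in>I - {i}. g i j)"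
proof -
  have "(\<Sum>k\<in>I. \<Sum>i\<in>I - {k}. \<Sum>j\<in>I - {k} - {i}. g i j)
      = (\<Sum>k\<in>I. \<Sum>i | i \<in> I \<and> i \<noteq> k. \<Sum>j\<in>I - {i} - {k}. g i j)"
    by (intro sum.cong) auto
  also have "\<dots> = (\<Sum>i\<in>I. \<Sum>k | k \<in> I \<and> i \<noteq> k. \<Sum>j\<in>I - {i} - {k}. g i j)"
    using assms assms by (rule sum.swap_restrict)
  also have "\<dots> = (\<Sum>i\<in>I. \<Sum>k\<in>I - {i}. \<Sum>j\<in>I - {i} - {k}. g i j)"
    by (intro sum.cong) auto
  also have "\<dots> = (\<Sum>i\<in>I. (real (card I) - 2) * (\<Sum>j\<in>I - {i}. g i j))"
  proof (rule sum.cong)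
    fix i assume "i \<in> I"
    then have "real (card (I - {i})) - 1 = real (card I) - 2"
      using assms card_gt_0_iff[of I] by (auto simp: of_nat_diff)
    then show "(\<Sum>k\<in>I - {i}. \<Sum>j\<in>I - {i} - {k}. g i j)
        = (real (card I) - 2) * (\<Sum>j\<in>I - {i}. g i j)"
      using assms by (simp add: sum_leave_one_out)
  qed simp
  finally show ?thesis by (simp add: sum_distrib_left)
qed

text \<open>The survival counts \<open>m - 1\<close> and \<open>m - 2\<close> cancel against the
  normalisations for \<open>m - 1\<close> points; \<open>card I \<ge> 3\<close> keeps these
  nonzero.\<close>

lemma config_energy_average:
  assumes "finite I" "card I \<ge> 3"
  shows "(\<Sum>k\<in>I. config_energy Q (I - {k}) x) = card I * config_energy Q I x"
proof -
  define m where "m = real (card I)"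
  have m: "m \<ge> 3" using assms(2) by (simp add: m_def)
  have card: "real (card (I - {k})) = m - 1" if "k \<in> I" for k
    using that assms by (simp add: m_def of_nat_diff card_Diff_singleton)
  have "(\<Sum>k\<in>I. config_energy Q (I - {k}) x)
      = (\<Sum>k\<in>I. (\<Sum>i\<in>I - {k}. Q (x i)) / (m - 1)
          - (\<Sum>i\<in>I - {k}. \<Sum>j\<in>I - {k} - {i}. ln \<bar>x i - x j\<bar>) / ((m - 1) * (m - 2)))"
    by (intro sum.cong refl) (simp only: config_energy_def card, simp)
  also have "\<dots> = (m - 1) * (\<Sum>i\<in>I. Q (x i)) / (m - 1)
      - (m - 2) * (\<Sum>i\<in>I. \<Sum>j\<in>I - {i}. ln \<bar>x i - x j\<bar>) / ((m - 1) * (m - 2))"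
    using assms(1)
    by (simp only: sum_subtractf sum_divide_distrib[symmetric] sum_leave_one_out
        sum_pairs_leave_one_out m_def)
  also have "\<dots> = m * config_energy Q I x"
  proof -
    have "(m - 1) * S / (m - 1) = m * (S / m)" for S using m by simp
    moreover have "(m - 2) * L / ((m - 1) * (m - 2)) = m * (L / (m * (m - 1)))" for L
      using m by (simp add: divide_simps)
    ultimately show ?thesis
      unfolding config_energy_def m_def[symmetric] right_diff_distrib by (simp only:)
  qed
  finally show ?thesis by (simp add: m_def)
qed

lemma min_energy_le_Suc:
  assumes "n \<ge> 2"
  shows "min_energy Q n \<le> min_energy Q (n + 1)"
  unfolding min_energy_def[of Q "n + 1"]
proof (rule INF_greatest)
  fix x :: "nat \<Rightarrow> real"
  let ?I = "{1..n + 1}"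
  show "min_energy Q n \<le> energy Q (n + 1) x"
  proof (cases "inj_on x ?I")
    case False
    then show ?thesis using assms by (simp add: energy_eq_PInfty)
  next
    case True
    have le: "min_energy Q n \<le> ereal (config_energy Q (?I - {k}) x)" if "k \<in> ?I" for k
      using min_energy_le_config_energy[of "?I - {k}" x Q] True that
      by (simp add: inj_on_diff)
    \<comment> \<open>Some term of an average is at most the average.\<close>
    have "\<exists>k\<in>?I. config_energy Q (?I - {k}) x \<le> config_energy Q ?I x"
    proof (rule ccontr)
      assume "\<not> ?thesis"
      then have "(\<Sum>k\<in>?I. config_energy Q ?I x) < (\<Sum>k\<in>?I. config_energy Q (?I - {k}) x)"
        by (intro sum_strict_mono) (auto simp: not_le simp del: One_nat_def)
      then show False using config_energy_average[of ?I Q x] assms by simp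
    qed
    then obtain k where "k \<in> ?I" "config_energy Q (?I - {k}) x \<le> config_energy Q ?I x" ..
    with le[of k] show ?thesis
      unfolding energy_eq_config_energy[OF True] by (meson ereal_less_eq(3) order_trans)
  qed
qed

section \<open>The transport inequality at a minimiser\<close>

lemma W2_le_energy_gap:
  assumes rho: "\<rho> > 0" and conv: "convex_on UNIV (\<lambda>x. Q x - \<rho> * x\<^sup>2)"
    and n: "n \<ge> 2" and min: "energy Q n y = min_energy Q n"
  shows "ereal (\<rho> * (W2 (empirical n x) (empirical n y))\<^sup>2) \<le> energy Q n x - energy Q n y"
proof -
  let ?I = "{1..n}"
  have min_le: "min_energy Q n \<le> ereal (config_energy Q ?I z)" if "inj_on z ?I" for z
    using min_energy_le_config_energy[of ?I z Q] that by simp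
  have y: "inj_on y ?I"
  proof (rule ccontr)
    assume "\<not> inj_on y ?I"
    then have "min_energy Q n = \<infinity>" using n min energy_eq_PInfty by metis
    \<comment> \<open>The points \<open>1, ..., n\<close> form an injective configuration, whose
      finite energy keeps the infimum below \<open>\<infinity>\<close>.\<close>
    then show False using min_le[of real] by (simp add: inj_on_def)
  qed
  note Ey = energy_eq_config_energy[OF y, of Q]
  show ?thesis
  proof (cases "inj_on x ?I")
    case False
    \<comment> \<open>Here \<open>x\<close> has infinite energy while that of \<open>y\<close> is
      real, so the gap is infinite.\<close>
    then show ?thesis using n by (simp add: energy_eq_PInfty Ey)
  next
    case True
    obtain f where f: "bij_betw f ?I ?I" "strict_mono_on ?I (x \<circ> f)"
      using ex_strict_mono_reindexing[OF True] .
    obtain g where g: "bij_betw g ?I ?I" "strict_mono_on ?I (y \<circ> g)"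
      using ex_strict_mono_reindexing[OF y] .
    \<comment> \<open>Sorting \<open>x\<close> and \<open>y\<close> separately changes neither the
      empirical measures nor the energies, and puts both into the same chamber.\<close>
    let ?x = "x \<circ> f" and ?y = "y \<circ> g"
    have "\<rho> * (W2 (empirical n x) (empirical n y))\<^sup>2
        \<le> \<rho> * ((\<Sum>i\<in>?I. (?x i - ?y i)\<^sup>2) / card ?I)"
      using W2_empirical_le[of n ?x ?y] rho n
      unfolding empirical_reindex[OF f(1)] empirical_reindex[OF g(1)]
      by (intro mult_left_mono) simp_all
    also have "\<dots> \<le> config_energy Q ?I ?x - config_energy Q ?I ?y"
    proof (rule config_energy_minimizer_gap[OF conv])
      fix i j assume ij: "i \<in> ?I" "j \<in> ?I" "i \<noteq> j"
      consider "i < j" | "j < i" using ij(3) by linarith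
      then show "0 < (?y i - ?y j) * (?x i - ?x j)"
      proof cases
        case 1
        then show ?thesis using ij strict_mono_onD[OF f(2)] strict_mono_onD[OF g(2)]
          by (intro mult_neg_neg) simp_all
      next
        case 2
        then show ?thesis using ij strict_mono_onD[OF f(2)] strict_mono_onD[OF g(2)]
          by (intro mult_pos_pos) simp_all
      qed
    next
      fix z :: "nat \<Rightarrow> real" assume "inj_on z ?I"
      then show "config_energy Q ?I ?y \<le> config_energy Q ?I z"
        using min_le[of z] min Ey unfolding config_energy_reindex[OF g(1), symmetric]
          by (metis ereal_less_eq(3))
    qed
    finally show ?thesis
      unfolding config_energy_reindex[OF f(1), symmetric] config_energy_reindex[OF g(1), symmetric]
        Ey energy_eq_config_energy[OF True] by simp
  qed
qed

theorem theorem2p16: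
  fixes \<rho> :: real and Q :: "real \<Rightarrow> real"
  assumes "\<rho> > 0"
    and "convex_on UNIV (\<lambda>x. Q x - \<rho> * x\<^sup>2)"
  shows "(\<forall>n\<ge>2. \<forall>y\<in>Rn n. energy Q n y = min_energy Q n \<longrightarrow>
            (\<forall>x\<in>Rn n.
               ereal (\<rho> * (W2 (empirical n x) (empirical n y))\<^sup>2) \<le> energy Q n x - energy Q n y
             \<and> energy Q n x - energy Q n y = energy Q n x - min_energy Q n))
       \<and> (\<forall>n\<ge>2. min_energy Q n \<le> min_energy Q (n + 1))"
  using W2_le_energy_gap[OF assms] min_energy_le_Suc by simp

end
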